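(* Let $M$ be a matroid on a finite ground set $E$ with rank function $r_M$, let $q$ be a non-zero (complex) number, and let $\bm v=(v_e)_{e\in E}$ and $\bm u=(u_e)_{e\in E}$ be sequences of non-zero (complex) numbers indexed by $E$. Then $$\widetilde Z(M;q,\bm v)=\Big(\prod_{e\in E}\frac{v_e}{u_e}\Big)\sum_{F\subseteq E}\Big(\prod_{e\in F}\Big(\frac{u_e}{v_e}-1\Big)\Big)\,\widetilde Z\big(M-F;q,(u_e)_{e\in E-F}\big).$$
   Context: A matroid $M$ on a finite ground set $E$ is determined by its rank function $r_M:2^E\to\mathbb Z_{\ge 0}$. For a non-zero number $q$ and a sequence $\bm v=(v_e)_{e\in E}$ of numbers, the normalized Potts model partition function of $M$ is $$\widetilde Z(M;q,\bm v)=\sum_{A\subseteq E}q^{-r_M(A)}\prod_{e\in A}v_e.$$ For $F\subseteq E$, the deletion $M-F$ is the matroid on $E-F$ with rank function $r_{M-F}(A)=r_M(A)$ for all $A\subseteq E-F$. Empty products equal $1$. *)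

theory Defs
  imports Complex_Main
begin

text \<open>
  A matroid is given by its ground set and its rank function; \<open>matroid\<close> states the usual
  rank axioms. The values of \<open>rk\<close> on sets that are not contained in the ground set are
  irrelevant and left unconstrained.
\<close>

record 'a matroid_data =
  ground :: "'a set"
  rk :: "'a set \<Rightarrow> nat"

definition matroid :: "'a matroid_data \<Rightarrow> bool" where
  "matroid M \<longleftrightarrow>
     finite (ground M) \<and>
     (\<forall>A. A \<subseteq> ground M \<longrightarrow> rk M A \<le> card A) \<and>
     (\<forall>A B. A \<subseteq> B \<and> B \<subseteq> ground M \<longrightarrow> rk M A \<le> rk M B) \<and>
     (\<forall>A B. A \<subseteq> ground M \<and> B \<subseteq> ground M \<longrightarrow>
        rk M (A \<union> B) + rk M (A \<inter> B) \<le> rk M A + rk M B)"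

definition deletion :: "'a matroid_data \<Rightarrow> 'a set \<Rightarrow> 'a matroid_data" where
  "deletion M F = \<lparr>ground = ground M - F, rk = rk M\<rparr>"

lemma matroid_deletion: "matroid M \<Longrightarrow> matroid (deletion M F)"
  by (auto simp: matroid_def deletion_def le_infI1 subset_iff)

text \<open>
  The weights form a total function on the element type, but only their values on the ground
  set matter. In particular the family \<open>(u\<^sub>e)\<close> with \<open>e\<close> restricted to \<open>E - F\<close> is again
  represented by \<open>u\<close> when it is used with \<open>deletion M F\<close>.
\<close>

definition potts_norm :: "'a matroid_data \<Rightarrow> complex \<Rightarrow> ('a \<Rightarrow> complex) \<Rightarrow> complex" where
  "potts_norm M q v = (\<Sum>A\<in>Pow (ground M). q powi (- int (rk M A)) * (\<Prod>e\<in>A. v e))"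

lemma potts_norm_cong:
  assumes "\<And>e. e \<in> ground M \<Longrightarrow> v e = w e"
  shows "potts_norm M q v = potts_norm M q w"
  unfolding potts_norm_def using assms
  by (intro sum.cong refl arg_cong2[where f = "(*)"] prod.cong) auto

end

theory Submission
  imports Defs
begin

text \<open>
  Exchange the two summations: a set \<open>A\<close> contributes to the summand of \<open>F\<close> precisely when
  \<open>F \<subseteq> E - A\<close>. Expanding \<open>\<Prod>e\<in>E - A. (u\<^sub>e / v\<^sub>e - 1) + 1\<close> shows that the sum over all such \<open>F\<close>
  is \<open>\<Prod>e\<in>E - A. u\<^sub>e / v\<^sub>e\<close>, and together with the prefactor this turns \<open>\<Prod>e\<in>A. u\<^sub>e\<close> into
  \<open>\<Prod>e\<in>A. v\<^sub>e\<close>.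
\<close>

lemma sum_Pow_prod_minus_one:
  fixes f :: "'a \<Rightarrow> 'b::comm_ring_1"
  assumes "finite S"
  shows "(\<Sum>F\<in>Pow S. \<Prod>e\<in>F. f e - 1) = (\<Prod>e\<in>S. f e)"
  using prod_add[OF assms, of "\<lambda>e. f e - 1" "\<lambda>_. 1"] by simp

theorem theorem3p2:
  fixes M :: "'a matroid_data" and q :: complex and v u :: "'a \<Rightarrow> complex"
  assumes "matroid M"
    and "q \<noteq> 0"
    and "\<And>e. e \<in> ground M \<Longrightarrow> v e \<noteq> 0"
    and "\<And>e. e \<in> ground M \<Longrightarrow> u e \<noteq> 0"
  shows "potts_norm M q v =
    (\<Prod>e\<in>ground M. v e / u e) *
      (\<Sum>F\<in>Pow (ground M). (\<Prod>e\<in>F. u e / v e - 1) * potts_norm (deletion M F) q u)"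
proof -
  define E where "E = ground M"
  define c where "c A = q powi (- int (rk M A))" for A
  have fin: "finite E"
    using assms(1) by (simp add: matroid_def E_def)
  have nz: "v e \<noteq> 0" "u e \<noteq> 0" if "e \<in> E" for e
    using assms(3,4) that by (auto simp: E_def)
  \<comment> \<open>The prefactor splits over \<open>E - A\<close> and \<open>A\<close>. On
    \<open>E - A\<close> it cancels the inverse ratios; on \<open>A\<close> it trades each
    \<open>u e\<close> for \<open>v e\<close>.\<close>
  have weight: "(\<Prod>e\<in>E. v e / u e) * ((\<Prod>e\<in>A. u e) * (\<Prod>e\<in>E - A. u e / v e)) = (\<Prod>e\<in>A. v e)"
    if A: "A \<subseteq> E" for A
  proof -
    have "(\<Prod>e\<in>E. v e / u e) = (\<Prod>e\<in>E - A. v e / u e) * (\<Prod>e\<in>A. v e / u e)"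
      using A fin by (rule prod.subset_diff)
    moreover have "(\<Prod>e\<in>E - A. v e / u e) * (\<Prod>e\<in>E - A. u e / v e) = 1"
      unfolding prod.distrib[symmetric] using nz by (intro prod.neutral) auto
    moreover have "(\<Prod>e\<in>A. v e / u e) * (\<Prod>e\<in>A. u e) = (\<Prod>e\<in>A. v e)"
      unfolding prod.distrib[symmetric] using nz A by (intro prod.cong) auto
    ultimately show ?thesis
      by (metis (no_types, lifting) mult.assoc mult.commute mult_1)
  qed
  \<comment> \<open>Deletion keeps the rank function, so \<open>c A\<close> does not depend on
    \<open>F\<close>. Writing subsets of \<open>E - F\<close> as those \<open>A \<in> Pow E\<close>
    disjoint from \<open>F\<close> gives the symmetric condition that
    \<open>sum.swap_restrict\<close> expects.\<close>
  have "(\<Sum>F\<in>Pow E. (\<Prod>e\<in>F. u e / v e - 1) * potts_norm (deletion M F) q u)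
      = (\<Sum>F\<in>Pow E. \<Sum>A | A \<in> Pow E \<and> A \<inter> F = {}. (\<Prod>e\<in>F. u e / v e - 1) * (c A * (\<Prod>e\<in>A. u e)))"
    by (auto simp: potts_norm_def deletion_def c_def E_def sum_distrib_left intro!: sum.cong)
  also have "\<dots> = (\<Sum>A\<in>Pow E. \<Sum>F | F \<in> Pow E \<and> A \<inter> F = {}. (\<Prod>e\<in>F. u e / v e - 1) * (c A * (\<Prod>e\<in>A. u e)))"
    using fin by (intro sum.swap_restrict) auto
  \<comment> \<open>For fixed \<open>A\<close>, the sets \<open>F\<close> disjoint from it are the
    subsets of \<open>E - A\<close>, and the factor free of \<open>F\<close> comes out.\<close>
  also have "\<dots> = (\<Sum>A\<in>Pow E. (\<Sum>F\<in>Pow (E - A). \<Prod>e\<in>F. u e / v e - 1) * (c A * (\<Prod>e\<in>A. u e)))"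
    unfolding sum_distrib_right by (intro sum.cong) auto
  also have "\<dots> = (\<Sum>A\<in>Pow E. c A * ((\<Prod>e\<in>A. u e) * (\<Prod>e\<in>E - A. u e / v e)))"
    using fin by (simp add: sum_Pow_prod_minus_one mult_ac)
  finally have "(\<Prod>e\<in>E. v e / u e) *
      (\<Sum>F\<in>Pow E. (\<Prod>e\<in>F. u e / v e - 1) * potts_norm (deletion M F) q u)
      = (\<Sum>A\<in>Pow E. c A * ((\<Prod>e\<in>E. v e / u e) * ((\<Prod>e\<in>A. u e) * (\<Prod>e\<in>E - A. u e / v e))))"
    by (simp only: sum_distrib_left mult.left_commute)
  also have "\<dots> = (\<Sum>A\<in>Pow E. c A * (\<Prod>e\<in>A. v e))"
    by (intro sum.cong refl) (simp only: weight Pow_iff)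
  also have "\<dots> = potts_norm M q v"
    by (simp add: potts_norm_def c_def E_def)
  finally show ?thesis
    by (simp add: E_def)
qed

end
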